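(* Let $(X,G,K)$ be a $G$-complete $G$-metric type space and let $T:X\to X$ be a mapping such that $T^n$ is Lipschitzian for all $n\ge 1$ and $\sum_{n=0}^\infty \mathrm{Lip}(T^n)<\infty$. Then $T$ has a unique fixed point $x^*\in X$. In fact, $T$ is a Picard operator.
   Context: A $G$-metric type space $(X,G,K)$ is a nonempty set $X$ with a constant $K>0$ and a function $G:X\times X\times X\to[0,\infty)$ such that: (G1) $G(x,y,z)=0$ if $x=y=z$; (G2) $G(x,x,y)>0$ whenever $x\ne y$; (G3) $G(x,x,y)\le G(x,y,z)$ whenever $z\neq y$; (G4) $G$ is symmetric in its three variables; (G5) $G(x,y,z)\le K[G(x,z_1,z_1)+G(z_1,z_2,z_2)+\cdots+G(z_{n-1},z_n,z_n)+G(z_n,y,z)]$ for all $n\ge1$ and all $x,y,z,z_1,\dots,z_n\in X$. A sequence $(x_n)$ in $X$ is $G$-convergent to $x\in X$ if $\lim_{n,m\to\infty}G(x,x_n,x_m)=0$. It is $G$-Cauchy if for each $\varepsilon>0$ there is $N\in\mathbb N$ with $G(x_n,x_m,x_m)<\varepsilon$ for all $m,n\ge N$. The space is $G$-complete if every $G$-Cauchy sequence is $G$-convergent in $X$. A mapping $S:X\to X$ is Lipschitzian if there is a constant $k\ge 0$ with $G(Sx,Sy,Sz)\le k\,G(x,y,z)$ for all $x,y,z\in X$; the smallest such constant is denoted $\mathrm{Lip}(S)$. $T^n$ is the $n$-th iterate of $T$, with $T^0$ the identity. $T$ is a Picard operator if it has a unique fixed point $x^*$ and, for every $x\in X$, the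 sequence $(T^nx)$ $G$-converges to $x^*$. *)

theory Defs
  imports "HOL-Analysis.Analysis"
begin

text \<open>Spaces are given by a carrier set \<open>X\<close>; the values of \<open>G\<close> outside \<open>X\<close> are irrelevant.
  In \<open>polygon\<close>, the intermediate points are \<open>w 1, \<dots>, w n\<close>.
  The two transpositions in \<open>symmetric\<close> generate all permutations of the three arguments.\<close>

locale G_metric_type_space =
  fixes X :: "'a set" and G :: "'a \<Rightarrow> 'a \<Rightarrow> 'a \<Rightarrow> real" and K :: real
  assumes nonempty: "X \<noteq> {}"
    and K_pos: "K > 0"
    and nonneg: "\<lbrakk>x \<in> X; y \<in> X; z \<in> X\<rbrakk> \<Longrightarrow> G x y z \<ge> 0"
    and zero: "x \<in> X \<Longrightarrow> G x x x = 0"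
    and pos: "\<lbrakk>x \<in> X; y \<in> X; x \<noteq> y\<rbrakk> \<Longrightarrow> G x x y > 0"
    and mono: "\<lbrakk>x \<in> X; y \<in> X; z \<in> X; z \<noteq> y\<rbrakk> \<Longrightarrow> G x x y \<le> G x y z"
    and symmetric: "\<lbrakk>x \<in> X; y \<in> X; z \<in> X\<rbrakk> \<Longrightarrow> G x y z = G y x z \<and> G x y z = G x z y"
    and polygon: "\<lbrakk>(n::nat) \<ge> 1; x \<in> X; y \<in> X; z \<in> X; \<And>i. i \<in> {1..n} \<Longrightarrow> w i \<in> X\<rbrakk> \<Longrightarrow>
      G x y z \<le> K * (G x (w 1) (w 1) + (\<Sum>i = 1..<n. G (w i) (w (i + 1)) (w (i + 1)))
                      + G (w n) y z)"

definition G_convergent_to ::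
    "('a \<Rightarrow> 'a \<Rightarrow> 'a \<Rightarrow> real) \<Rightarrow> (nat \<Rightarrow> 'a) \<Rightarrow> 'a \<Rightarrow> bool" where
  "G_convergent_to G s x \<longleftrightarrow>
     ((\<lambda>(n, m). G x (s n) (s m)) \<longlongrightarrow> 0) (sequentially \<times>\<^sub>F sequentially)"

definition G_Cauchy :: "('a \<Rightarrow> 'a \<Rightarrow> 'a \<Rightarrow> real) \<Rightarrow> (nat \<Rightarrow> 'a) \<Rightarrow> bool" where
  "G_Cauchy G s \<longleftrightarrow> (\<forall>\<epsilon>>0. \<exists>N. \<forall>m\<ge>N. \<forall>n\<ge>N. G (s n) (s m) (s m) < \<epsilon>)"

definition G_complete :: "'a set \<Rightarrow> ('a \<Rightarrow> 'a \<Rightarrow> 'a \<Rightarrow> real) \<Rightarrow> bool" where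
  "G_complete X G \<longleftrightarrow>
     (\<forall>s. (\<forall>n. s n \<in> X) \<and> G_Cauchy G s \<longrightarrow> (\<exists>x\<in>X. G_convergent_to G s x))"

definition G_Lipschitz_constant ::
    "'a set \<Rightarrow> ('a \<Rightarrow> 'a \<Rightarrow> 'a \<Rightarrow> real) \<Rightarrow> ('a \<Rightarrow> 'a) \<Rightarrow> real \<Rightarrow> bool" where
  "G_Lipschitz_constant X G S k \<longleftrightarrow>
     k \<ge> 0 \<and> (\<forall>x\<in>X. \<forall>y\<in>X. \<forall>z\<in>X. G (S x) (S y) (S z) \<le> k * G x y z)"

definition G_Lipschitzian ::
    "'a set \<Rightarrow> ('a \<Rightarrow> 'a \<Rightarrow> 'a \<Rightarrow> real) \<Rightarrow> ('a \<Rightarrow> 'a) \<Rightarrow> bool" where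
  "G_Lipschitzian X G S \<longleftrightarrow> (\<exists>k. G_Lipschitz_constant X G S k)"

text \<open>For a Lipschitzian map the least constant exists, see \<open>G_Lip_least\<close> below.\<close>

definition G_Lip ::
    "'a set \<Rightarrow> ('a \<Rightarrow> 'a \<Rightarrow> 'a \<Rightarrow> real) \<Rightarrow> ('a \<Rightarrow> 'a) \<Rightarrow> real" where
  "G_Lip X G S = (LEAST k. G_Lipschitz_constant X G S k)"

definition Picard_operator ::
    "'a set \<Rightarrow> ('a \<Rightarrow> 'a \<Rightarrow> 'a \<Rightarrow> real) \<Rightarrow> ('a \<Rightarrow> 'a) \<Rightarrow> bool" where
  "Picard_operator X G T \<longleftrightarrow>
     (\<exists>p\<in>X. T p = p \<and> (\<forall>q\<in>X. T q = q \<longrightarrow> q = p) \<and>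
        (\<forall>x\<in>X. G_convergent_to G (\<lambda>n. (T ^^ n) x) p))"

lemma G_Lip_least:
  assumes "G_Lipschitzian X G S"
  shows "G_Lipschitz_constant X G S (G_Lip X G S)"
    and "G_Lipschitz_constant X G S k \<Longrightarrow> G_Lip X G S \<le> k"
proof -
  let ?A = "Collect (G_Lipschitz_constant X G S)"
  have A: "?A = {0..} \<inter> (\<Inter>x\<in>X. \<Inter>y\<in>X. \<Inter>z\<in>X. {k. G (S x) (S y) (S z) \<le> k * G x y z})"
    by (auto simp: G_Lipschitz_constant_def)
  have "closed ?A"
    unfolding A by (intro closed_Int closed_INT ballI closed_Collect_le continuous_intros closed_atLeast)
  moreover have "?A \<noteq> {}" using assms by (auto simp: G_Lipschitzian_def)
  moreover have bdd: "bdd_below ?A"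
    by (rule bdd_belowI[of _ 0]) (auto simp: G_Lipschitz_constant_def)
  ultimately have "Inf ?A \<in> ?A" by (intro closed_contains_Inf)
  then have Inf: "G_Lipschitz_constant X G S (Inf ?A)" by simp
  have least: "Inf ?A \<le> k" if "G_Lipschitz_constant X G S k" for k
    using that bdd by (intro cInf_lower) auto
  have "G_Lip X G S = Inf ?A"
    unfolding G_Lip_def using Inf least by (rule Least_equality)
  then show "G_Lipschitz_constant X G S (G_Lip X G S)"
    and "G_Lipschitz_constant X G S k \<Longrightarrow> G_Lip X G S \<le> k"
    using Inf least by auto
qed

end

theory Submission
  imports Defs
begin

text \<open>The orbit \<open>x, T x, T\<^sup>2 x, \<dots>\<close> satisfies
  \<open>G (T\<^sup>n x) (T\<^sup>m x) (T\<^sup>m x) \<le> K * G x (T x) (T x) * (\<Sum>i=n..<m. Lip (T\<^sup>i))\<close> for \<open>n \<le> m\<close>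
  by the polygon inequality, so it is Cauchy, and its limit is fixed because \<open>T\<close> is Lipschitzian.
  As \<open>Lip (T\<^sup>n)\<close> tends to 0, two fixed points coincide, so that all orbits have the same limit.\<close>

context G_metric_type_space
begin

text \<open>Substitute for the symmetry of a metric: \<open>G u v v\<close> and
  \<open>G v u u\<close> may differ. Inserting \<open>u\<close> as the only intermediate point
  between \<open>v\<close> and the pair \<open>v\<close>, \<open>u\<close> gives two terms, and both
  equal \<open>G v u u\<close> by symmetry in the arguments.\<close>

lemma G_swap_le:
  assumes "u \<in> X" "v \<in> X"
  shows "G u v v \<le> 2 * K * G v u u"
proof -
  have "G v v u \<le> K * (G v u u + G u v u)"
    using polygon[of 1 v v u "\<lambda>_. u"] assms by simp
  moreover have "G u v u = G v u u" "G u v v = G v v u"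
    using symmetric assms by metis+
  ultimately show ?thesis by (simp add: algebra_simps)
qed

lemma eq_if_G_le_0:
  assumes "u \<in> X" "v \<in> X" "G u v v \<le> 0"
  shows "u = v"
proof (rule ccontr)
  assume "u \<noteq> v"
  then have "G v v u > 0" using pos assms by blast
  moreover have "G u v v = G v v u" using symmetric assms by metis
  ultimately show False using assms by simp
qed

lemma G_path_le:
  assumes "\<And>i. s i \<in> X" "n \<le> m"
  shows "G (s n) (s m) (s m) \<le> K * (\<Sum>i = n..<m. G (s i) (s (Suc i)) (s (Suc i)))"
proof (cases "n = m")
  case True
  then show ?thesis using zero assms by simp
next
  case False
  define k where "k = m - n"
  have k: "k \<ge> 1" "m = n + k" using False assms(2) by (auto simp: k_def)
  let ?d = "\<lambda>i. G (s i) (s (Suc i)) (s (Suc i))"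
  have "(\<Sum>i = n..<m. ?d i) = (\<Sum>i = 0..<k. ?d (n + i))"
    using sum.shift_bounds_nat_ivl[of ?d 0 n k] k by (simp add: add.commute)
  also have "\<dots> = ?d n + (\<Sum>i = 1..<k. ?d (n + i))"
    using k by (simp add: sum.atLeast_Suc_lessThan)
  \<comment> \<open>The last of the \<open>k\<close> intermediate points is \<open>s m\<close>
    itself, so the closing term of the polygon inequality is \<open>G (s m) (s m) (s m) = 0\<close>.
    At least one intermediate point is required, hence the separate case
    \<open>n = m\<close>.\<close>
  finally show ?thesis
    using polygon[of k "s n" "s m" "s m" "\<lambda>i. s (n + i)"] k assms(1) zero by simp
qed

lemma G_Cauchy_if_summable:
  assumes s: "\<And>i. s i \<in> X"
    and sum: "summable (\<lambda>i. G (s i) (s (Suc i)) (s (Suc i)))"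
  shows "G_Cauchy G s"
  unfolding G_Cauchy_def
proof (intro allI impI)
  fix \<epsilon> :: real
  assume \<epsilon>: "\<epsilon> > 0"
  let ?d = "\<lambda>i. G (s i) (s (Suc i)) (s (Suc i))"
  \<comment> \<open>The Cauchy condition covers both orders of the indices. For
    \<open>n \<le> m\<close> the path bound costs a factor \<open>K\<close>; for
    \<open>m < n\<close> the arguments are swapped first, which costs \<open>2 * K * K\<close>. As
    \<open>C\<close> dominates both, one \<open>N\<close> serves both cases.\<close>
  define C where "C = K + 2 * K * K"
  have C: "C > 0" "K \<le> C" "2 * K * K \<le> C" using K_pos by (auto simp: C_def add_pos_pos)
  obtain N where N: "\<And>m n. m \<ge> N \<Longrightarrow> norm (\<Sum>i = m..<n. ?d i) < \<epsilon> / C"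
    using sum \<epsilon> C unfolding summable_Cauchy by (meson divide_pos_pos)
  have D: "0 \<le> (\<Sum>i = n..<m. ?d i)" "C * (\<Sum>i = n..<m. ?d i) < \<epsilon>" if "n \<ge> N" for n m
  proof -
    show "0 \<le> (\<Sum>i = n..<m. ?d i)" by (intro sum_nonneg nonneg s)
    then show "C * (\<Sum>i = n..<m. ?d i) < \<epsilon>"
      using N[OF that, of m] C by (simp add: field_simps)
  qed
  have "G (s n) (s m) (s m) < \<epsilon>" if mn: "m \<ge> N" "n \<ge> N" for m n
  proof (cases "n \<le> m")
    case True
    have "G (s n) (s m) (s m) \<le> K * (\<Sum>i = n..<m. ?d i)" using G_path_le s True .
    also have "\<dots> \<le> C * (\<Sum>i = n..<m. ?d i)" using C D mn by (intro mult_right_mono)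
    finally show ?thesis using D(2)[OF mn(2), of m] by simp
  next
    case False
    then have "m \<le> n" by simp
    have "G (s n) (s m) (s m) \<le> 2 * K * G (s m) (s n) (s n)" using G_swap_le s by blast
    also have "\<dots> \<le> 2 * K * (K * (\<Sum>i = m..<n. ?d i))"
      using G_path_le[OF s \<open>m \<le> n\<close>] K_pos by (intro mult_left_mono) auto
    also have "\<dots> = 2 * K * K * (\<Sum>i = m..<n. ?d i)" by simp
    also have "\<dots> \<le> C * (\<Sum>i = m..<n. ?d i)" using C D mn by (intro mult_right_mono)
    finally show ?thesis using D(2)[OF mn(1), of n] by simp
  qed
  then show "\<exists>N. \<forall>m\<ge>N. \<forall>n\<ge>N. G (s n) (s m) (s m) < \<epsilon>" by blast
qed

text \<open>The point \<open>s (Suc n)\<close> is close to \<open>p\<close> by convergence, and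
  close to \<open>T p\<close> because it is the image of \<open>s n\<close> under the Lipschitzian
  \<open>T\<close>. Joining \<open>p\<close> to \<open>T p\<close> through it bounds
  \<open>G p (T p) (T p)\<close> by a null sequence.\<close>

lemma fixed_if_orbit_convergent:
  assumes T: "T \<in> X \<rightarrow> X" and L: "G_Lipschitz_constant X G T L"
    and x: "x \<in> X" and p: "p \<in> X" and conv: "G_convergent_to G (\<lambda>n. (T ^^ n) x) p"
  shows "T p = p"
proof -
  define s where "s n = (T ^^ n) x" for n
  have s: "s n \<in> X" for n
    unfolding s_def using T x by (induction n) auto
  have Tp: "T p \<in> X" using T p by blast
  \<comment> \<open>Convergence is a double limit; only its restriction to the diagonal is
    used.\<close>
  have lim: "(\<lambda>n. G p (s n) (s n)) \<longlonglongrightarrow> 0"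
    using filterlim_compose[OF conv[unfolded G_convergent_to_def]
        filterlim_Pair[OF filterlim_ident filterlim_ident]]
    by (simp add: s_def)
  have "G p (T p) (T p) \<le> K * (G p (s (Suc n)) (s (Suc n)) + 2 * K * (L * G p (s n) (s n)))" for n
  proof -
    have "G p (T p) (T p) \<le> K * (G p (s (Suc n)) (s (Suc n)) + G (s (Suc n)) (T p) (T p))"
      using polygon[of 1 p "T p" "T p" "\<lambda>_. s (Suc n)"] p Tp s by simp
    moreover have "G (s (Suc n)) (T p) (T p) \<le> 2 * K * (L * G p (s n) (s n))"
    proof -
      \<comment> \<open>The swap moves \<open>T p\<close> to the first place, so that the Lipschitz
        bound produces \<open>G p (s n) (s n)\<close>, the quantity known to vanish in the
        limit.\<close>
      have "G (s (Suc n)) (T p) (T p) \<le> 2 * K * G (T p) (s (Suc n)) (s (Suc n))"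
        using G_swap_le s Tp by blast
      also have "G (T p) (s (Suc n)) (s (Suc n)) \<le> L * G p (s n) (s n)"
        using L p s[of n] unfolding G_Lipschitz_constant_def s_def by simp
      finally show ?thesis using K_pos by (simp add: mult_left_mono)
    qed
    ultimately show ?thesis
      using K_pos by (meson add_left_mono less_imp_le mult_left_mono order_trans)
  qed
  moreover have "(\<lambda>n. K * (G p (s (Suc n)) (s (Suc n)) + 2 * K * (L * G p (s n) (s n)))) \<longlonglongrightarrow>
      K * (0 + 2 * K * (L * 0))"
    using lim LIMSEQ_Suc[OF lim] by (intro tendsto_intros)
  ultimately have "G p (T p) (T p) \<le> 0"
    using LIMSEQ_le_const by fastforce
  then show ?thesis using eq_if_G_le_0 p Tp by metis
qed

text \<open>Both points are fixed by every iterate, so \<open>G p q q\<close> is at most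
  \<open>L n\<close> times itself, and \<open>L n\<close> tends to 0.\<close>

lemma fixed_point_unique:
  assumes L: "\<And>n. n \<ge> 1 \<Longrightarrow> G_Lipschitz_constant X G (T ^^ n) (L n)" and lim: "L \<longlonglongrightarrow> 0"
    and "p \<in> X" "q \<in> X" and fp: "T p = p" "T q = q"
  shows "p = q"
proof -
  have fix_iter: "(T ^^ n) p = p" "(T ^^ n) q = q" for n
    using fp by (induction n) auto
  have "G p q q \<le> L n * G p q q" if "n \<ge> 1" for n
    using L[OF that] assms(3,4) fix_iter unfolding G_Lipschitz_constant_def by metis
  moreover have "(\<lambda>n. L n * G p q q) \<longlonglongrightarrow> 0 * G p q q"
    using lim by (intro tendsto_intros)
  ultimately have "G p q q \<le> 0"
    using LIMSEQ_le_const by fastforce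
  then show ?thesis using eq_if_G_le_0 assms by blast
qed

end

theorem theorem2p2:
  fixes X :: "'a set" and G :: "'a \<Rightarrow> 'a \<Rightarrow> 'a \<Rightarrow> real" and K :: real and T :: "'a \<Rightarrow> 'a"
  assumes "G_metric_type_space X G K"
    and "G_complete X G"
    and "T \<in> X \<rightarrow> X"
    and "\<And>n. n \<ge> 1 \<Longrightarrow> G_Lipschitzian X G (T ^^ n)"
    and "summable (\<lambda>n. G_Lip X G (T ^^ n))"
  shows "(\<exists>!p. p \<in> X \<and> T p = p) \<and> Picard_operator X G T"
proof -
  interpret G_metric_type_space X G K by fact
  define L where "L n = G_Lip X G (T ^^ n)" for n
  have L: "G_Lipschitz_constant X G (T ^^ n) (L n)" if "n \<ge> 1" for n
    unfolding L_def using G_Lip_least(1) assms(4) that by blast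
  have sumL: "summable L" unfolding L_def using assms(5) .
  have orbit: "\<exists>p\<in>X. T p = p \<and> G_convergent_to G (\<lambda>n. (T ^^ n) x) p" if x: "x \<in> X" for x
  proof -
    let ?s = "\<lambda>n. (T ^^ n) x"
    have s: "?s n \<in> X" for n
      using assms(3) x by (induction n) auto
    have Tx: "T x \<in> X" using assms(3) x by blast
    \<comment> \<open>Consecutive orbit points are the images of \<open>x\<close> and
      \<open>T x\<close> under \<open>T ^^ n\<close>. The bound is obtained for
      \<open>n \<ge> 1\<close>, which suffices since the comparison test ignores finitely many
      terms.\<close>
    have "norm (G (?s n) (?s (Suc n)) (?s (Suc n))) \<le> L n * G x (T x) (T x)" if "n \<ge> 1" for n
    proof -
      have "?s (Suc n) = (T ^^ n) (T x)" by (simp add: funpow_swap1)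
      then show ?thesis
        using L[OF that] x Tx nonneg[OF s s s, of n "Suc n" "Suc n"]
        unfolding G_Lipschitz_constant_def by simp
    qed
    then have "\<exists>N. \<forall>n\<ge>N. norm (G (?s n) (?s (Suc n)) (?s (Suc n))) \<le> L n * G x (T x) (T x)"
      by (intro exI[of _ 1]) simp
    then have "summable (\<lambda>n. G (?s n) (?s (Suc n)) (?s (Suc n)))"
      using summable_mult2[OF sumL] by (rule summable_comparison_test)
    then have "G_Cauchy G ?s"
      using s by (intro G_Cauchy_if_summable)
    then obtain p where p: "p \<in> X" "G_convergent_to G ?s p"
      using assms(2) s unfolding G_complete_def by (elim allE[of _ ?s]) blast
    moreover have "G_Lipschitz_constant X G T (L 1)"
      using L[of 1] by simp
    ultimately have "T p = p"
      using fixed_if_orbit_convergent[OF assms(3) _ x] by blast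
    then show ?thesis using p by blast
  qed
  have unique: "p = q" if "p \<in> X" "q \<in> X" "T p = p" "T q = q" for p q
    using fixed_point_unique[OF L summable_LIMSEQ_zero[OF sumL]] that by blast
  obtain x where "x \<in> X" using nonempty by blast
  then obtain p where p: "p \<in> X" "T p = p" using orbit by blast
  \<comment> \<open>A priori the limit depends on the starting point \<open>y\<close>; being a fixed
    point, it equals \<open>p\<close>.\<close>
  have "G_convergent_to G (\<lambda>n. (T ^^ n) y) p" if "y \<in> X" for y
    using orbit[OF that] unique p by blast
  then have "Picard_operator X G T"
    unfolding Picard_operator_def using p unique by blast
  then show ?thesis using p unique by blast
qed

end
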